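(* Let $(X,Y)$ and $(X',Y')$ be independent and identically distributed random vectors in $\mathbb{R}^2$ whose common joint distribution is bounded and symmetric. Suppose that $X-X'$ and $Y-Y'$ are independent. Then $X$ and $Y$ are independent.
   Context: The joint distribution of $(X,Y)$ is bounded if $X$ and $Y$ are (almost surely) bounded random variables. It is symmetric if $(X,Y)$ and $(-X,-Y)$ are identically distributed. *)

theory Defs
  imports "HOL-Probability.Probability"
begin

definition as_bounded :: "'a measure \<Rightarrow> ('a \<Rightarrow> real) \<Rightarrow> bool" where
  "as_bounded M X \<longleftrightarrow> (\<exists>B. AE \<omega> in M. \<bar>X \<omega>\<bar> \<le> B)"

definition identically_distributed ::
    "'a measure \<Rightarrow> ('a \<Rightarrow> 'b::topological_space) \<Rightarrow> ('a \<Rightarrow> 'b) \<Rightarrow> bool" where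
  "identically_distributed M Z W \<longleftrightarrow>
     Z \<in> borel_measurable M \<and> W \<in> borel_measurable M \<and> distr M borel Z = distr M borel W"

definition bounded_joint :: "'a measure \<Rightarrow> ('a \<Rightarrow> real) \<Rightarrow> ('a \<Rightarrow> real) \<Rightarrow> bool" where
  "bounded_joint M X Y \<longleftrightarrow> as_bounded M X \<and> as_bounded M Y"

definition symmetric_joint :: "'a measure \<Rightarrow> ('a \<Rightarrow> real) \<Rightarrow> ('a \<Rightarrow> real) \<Rightarrow> bool" where
  "symmetric_joint M X Y \<longleftrightarrow>
     identically_distributed M (\<lambda>\<omega>. (X \<omega>, Y \<omega>)) (\<lambda>\<omega>. (- X \<omega>, - Y \<omega>))"

end

theory Submission
  imports Defs "HOL-Complex_Analysis.Complex_Analysis"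
begin

text \<open>
  Since the vectors are bounded, F(s, t, z) = E exp(z (s X + t Y)) is entire in z. By symmetry
  F(s, t, -z) = F(s, t, z), so that the transform of (X - X', Y - Y') is F(s, t, z)^2, and the
  independence of the differences says that F(s, t, z)^2 = (F(s, 0, z) F(0, t, z))^2. Both bases
  are entire in z and equal 1 at z = 0, hence they agree everywhere; z = i gives the factorization
  of the joint characteristic function.

  Independence then follows from the one-dimensional uniqueness theorem, applied first to the law of
  X under a measure reweighted by 2 + cos(t Y) or 2 + sin(t Y), and then to the law of Y under a
  measure reweighted by 1 + 1_A(X). The added constants keep the weights positive.
\<close>

section \<open>Independence from a factorized characteristic function\<close>

context prob_space
begin

text \<open>Divided by the mean of \<open>D\<close>, the assumption \<open>char\<close> says that
  \<open>X\<close> has the same characteristic function under \<open>M\<close> as under the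
  probability measure with density \<open>D\<close> over its mean. Levy uniqueness makes the two
  laws of \<open>X\<close> equal, and comparing them on \<open>A\<close> gives the claim. The lower
  bound on \<open>D\<close> keeps its mean away from 0; the upper bound makes \<open>D\<close>
  integrable.\<close>

lemma weight_independent_of_char:
  fixes X D :: "'a \<Rightarrow> real"
  assumes [measurable]: "random_variable borel X" "random_variable borel D"
    and D1: "\<And>\<omega>. 1 \<le> D \<omega>" and D2: "\<And>\<omega>. D \<omega> \<le> c"
    and char: "\<And>s. expectation (\<lambda>\<omega>. D \<omega> *\<^sub>R iexp (s * X \<omega>)) =
      expectation D *\<^sub>R expectation (\<lambda>\<omega>. iexp (s * X \<omega>))"
    and [measurable]: "A \<in> sets borel"
  shows "expectation (\<lambda>\<omega>. indicat_real A (X \<omega>) * D \<omega>) =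
    expectation (\<lambda>\<omega>. indicat_real A (X \<omega>)) * expectation D"
proof -
  have D_pos: "0 < D \<omega>" for \<omega> using D1[of \<omega>] by linarith
  have intD: "integrable M D"
    by (rule integrable_const_bound[where B = c]) (use D_pos D2 in \<open>auto simp: less_imp_le\<close>)
  define d where "d = expectation D"
  have "1 \<le> d" unfolding d_def
    using integral_mono[of M "\<lambda>_. 1" D] intD D1 by (simp add: prob_space)
  hence d: "d > 0" by simp
  define N where "N = density M (\<lambda>\<omega>. ennreal (D \<omega> / d))"
  \<comment> \<open>The value type is left general because the formula is needed for complex
    exponentials when comparing characteristic functions and for a real indicator at the
    end.\<close>
  have intN: "integral\<^sup>L N f = (1 / d) *\<^sub>R expectation (\<lambda>\<omega>. D \<omega> *\<^sub>R f \<omega>)"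
    if "f \<in> borel_measurable M" for f :: "'a \<Rightarrow> 'b :: {banach, second_countable_topology}"
  proof -
    have "integral\<^sup>L N f = expectation (\<lambda>\<omega>. (D \<omega> / d) *\<^sub>R f \<omega>)"
      unfolding N_def by (rule integral_density) (use that D_pos d in \<open>auto simp: less_imp_le\<close>)
    also have "\<dots> = (1 / d) *\<^sub>R expectation (\<lambda>\<omega>. D \<omega> *\<^sub>R f \<omega>)"
      by (simp flip: integral_scaleR_right)
    finally show ?thesis .
  qed
  have [measurable_cong]: "sets N = sets M" by (simp add: N_def)
  interpret N: prob_space N
  proof
    have "emeasure N (space N) = (\<integral>\<^sup>+ \<omega>. ennreal (D \<omega> / d) \<partial>M)"
      unfolding N_def by (subst emeasure_density) (auto intro!: nn_integral_cong)
    also have "\<dots> = ennreal (expectation (\<lambda>\<omega>. D \<omega> / d))"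
      by (rule nn_integral_eq_integral) (use intD D_pos d in \<open>auto simp: less_imp_le\<close>)
    finally show "emeasure N (space N) = 1"
      using d by (simp add: d_def[symmetric])
  qed
  have "distr N borel X = distr M borel X"
  proof (rule Levy_uniqueness)
    show "real_distribution (distr N borel X)"
      by (rule N.real_distribution_distr) simp
    show "real_distribution (distr M borel X)"
      by (rule real_distribution_distr) simp
    show "char (distr N borel X) = char (distr M borel X)"
    proof
      fix s
      have "char (distr N borel X) s = integral\<^sup>L N (\<lambda>\<omega>. iexp (s * X \<omega>))"
        unfolding char_def by (rule integral_distr) auto
      also have "\<dots> = expectation (\<lambda>\<omega>. iexp (s * X \<omega>))"
        by (subst intN) (use char[of s] d in \<open>auto simp: d_def[symmetric]\<close>)
      also have "\<dots> = char (distr M borel X) s"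
        unfolding char_def by (rule integral_distr[symmetric]) auto
      finally show "char (distr N borel X) s = char (distr M borel X) s" .
    qed
  qed
  hence "integral\<^sup>L (distr N borel X) (indicat_real A) = integral\<^sup>L (distr M borel X) (indicat_real A)"
    by simp
  hence "integral\<^sup>L N (\<lambda>\<omega>. indicat_real A (X \<omega>)) = expectation (\<lambda>\<omega>. indicat_real A (X \<omega>))"
    by (subst (asm) (1 2) integral_distr) auto
  thus ?thesis
    by (subst (asm) intN) (use d in \<open>auto simp: d_def[symmetric] field_simps\<close>)
qed

text \<open>The exponentials are traded for indicators one variable at a time: \<open>half\<close>
  has an indicator of \<open>X\<close> and still an exponential of \<open>Y\<close>, while
  \<open>prod\<close> has indicators of both. This gives the product formula on measurable
  rectangles, which determine the joint law.\<close>

lemma indep_varI_char: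
  fixes X Y :: "'a \<Rightarrow> real"
  assumes [measurable]: "random_variable borel X" "random_variable borel Y"
    and char: "\<And>s t. expectation (\<lambda>\<omega>. iexp (s * X \<omega> + t * Y \<omega>)) =
      expectation (\<lambda>\<omega>. iexp (s * X \<omega>)) * expectation (\<lambda>\<omega>. iexp (t * Y \<omega>))"
  shows "indep_var borel X borel Y"
proof -
  have int: "integrable M (\<lambda>\<omega>. iexp (f \<omega>))" if [measurable]: "f \<in> borel_measurable M" for f :: "'a \<Rightarrow> real"
    by (rule integrable_const_bound[where B = 1]) auto
  have int': "integrable M (\<lambda>\<omega>. f \<omega> * g \<omega>)"
    if [measurable]: "f \<in> borel_measurable M" "g \<in> borel_measurable M"
      and "\<And>\<omega>. \<bar>f \<omega>\<bar> \<le> 1" "\<And>\<omega>. \<bar>g \<omega>\<bar> \<le> 1"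
    for f g :: "'a \<Rightarrow> real"
    by (rule integrable_const_bound[where B = 1])
       (use that in \<open>auto simp: abs_mult intro!: mult_le_one\<close>)
  have cos_eq: "complex_of_real (cos x) = (iexp x + iexp (- x)) / 2" for x
    by (simp add: complex_eq_iff Re_exp Im_exp)
  have sin_eq: "complex_of_real (sin x) = (iexp x - iexp (- x)) / (2 * \<i>)" for x
    by (simp add: complex_eq_iff Re_exp Im_exp Re_divide Im_divide)
  have exp_mult: "iexp (s * X \<omega>) * iexp (t * Y \<omega>) = iexp (s * X \<omega> + t * Y \<omega>)" for s t \<omega>
    by (simp add: exp_add[symmetric] algebra_simps)
  have half: "expectation (\<lambda>\<omega>. indicat_real A (X \<omega>) *\<^sub>R iexp (t * Y \<omega>)) =
      expectation (\<lambda>\<omega>. indicat_real A (X \<omega>)) *\<^sub>R expectation (\<lambda>\<omega>. iexp (t * Y \<omega>))"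
    if [measurable]: "A \<in> sets borel" for A t
  proof -
    \<comment> \<open>A complex exponential cannot serve as a density, so the weight is a real
      \<open>f\<close>, later cosine and sine. As a combination of exponentials at \<open>t\<close>
      and \<open>-t\<close>, it inherits the factorization from \<open>char\<close> by
      linearity.\<close>
    have trig: "expectation (\<lambda>\<omega>. indicat_real A (X \<omega>) * f (t * Y \<omega>)) =
        expectation (\<lambda>\<omega>. indicat_real A (X \<omega>)) * expectation (\<lambda>\<omega>. f (t * Y \<omega>))"
      if [measurable]: "f \<in> borel_measurable borel" and b: "\<And>x. \<bar>f x\<bar> \<le> 1"
        and f: "\<And>x. complex_of_real (f x) = a * iexp x + b * iexp (- x)"
      for f :: "real \<Rightarrow> real" and a b
    proof -
      have intf: "integrable M (\<lambda>\<omega>. f (t * Y \<omega>))"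
        by (rule integrable_const_bound[where B = 1]) (use b in auto)
      have Ef: "complex_of_real (expectation (\<lambda>\<omega>. f (t * Y \<omega>))) =
          a * expectation (\<lambda>\<omega>. iexp (t * Y \<omega>)) + b * expectation (\<lambda>\<omega>. iexp ((- t) * Y \<omega>))"
        unfolding integral_complex_of_real[symmetric] f
        using int[of "\<lambda>\<omega>. t * Y \<omega>"] int[of "\<lambda>\<omega>. (- t) * Y \<omega>"] by simp
      have Efe: "expectation (\<lambda>\<omega>. complex_of_real (f (t * Y \<omega>)) * iexp (s * X \<omega>)) =
         complex_of_real (expectation (\<lambda>\<omega>. f (t * Y \<omega>))) * expectation (\<lambda>\<omega>. iexp (s * X \<omega>))" for s
      proof -
        have "complex_of_real (f (t * Y \<omega>)) * iexp (s * X \<omega>) =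
          a * iexp (s * X \<omega> + t * Y \<omega>) + b * iexp (s * X \<omega> + (- t) * Y \<omega>)" for \<omega>
          unfolding f exp_mult[symmetric] by (simp add: algebra_simps)
        hence "expectation (\<lambda>\<omega>. complex_of_real (f (t * Y \<omega>)) * iexp (s * X \<omega>)) =
          a * expectation (\<lambda>\<omega>. iexp (s * X \<omega> + t * Y \<omega>)) +
          b * expectation (\<lambda>\<omega>. iexp (s * X \<omega> + (- t) * Y \<omega>))"
          using int[of "\<lambda>\<omega>. s * X \<omega> + t * Y \<omega>"] int[of "\<lambda>\<omega>. s * X \<omega> + (- t) * Y \<omega>"] by simp
        thus ?thesis unfolding char Ef by (simp only: algebra_simps)
      qed
      \<comment> \<open>Since \<open>f\<close> is bounded by 1 in absolute value, the shifted weight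
        lies between 1 and 3. The constant 2 contributes the same term to both sides and cancels
        afterwards.\<close>
      have "expectation (\<lambda>\<omega>. indicat_real A (X \<omega>) * (2 + f (t * Y \<omega>))) =
          expectation (\<lambda>\<omega>. indicat_real A (X \<omega>)) * expectation (\<lambda>\<omega>. 2 + f (t * Y \<omega>))"
      proof (rule weight_independent_of_char)
        show "1 \<le> 2 + f (t * Y \<omega>)" "2 + f (t * Y \<omega>) \<le> 3" for \<omega>
          using b[of "t * Y \<omega>"] by linarith+
        fix s
        have i: "integrable M (\<lambda>\<omega>. complex_of_real (f (t * Y \<omega>)) * iexp (s * X \<omega>))"
          by (rule integrable_const_bound[where B = 1]) (use b in \<open>auto simp: norm_mult\<close>)
        show "expectation (\<lambda>\<omega>. (2 + f (t * Y \<omega>)) *\<^sub>R iexp (s * X \<omega>)) =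
          expectation (\<lambda>\<omega>. 2 + f (t * Y \<omega>)) *\<^sub>R expectation (\<lambda>\<omega>. iexp (s * X \<omega>))"
          using Efe[of s] i int[of "\<lambda>\<omega>. s * X \<omega>"] intf
          by (simp add: scaleR_conv_of_real distrib_right prob_space)
      qed auto
      moreover have "integrable M (\<lambda>\<omega>. indicat_real A (X \<omega>) * f (t * Y \<omega>))"
        by (rule int') (use b in \<open>auto simp: indicator_def\<close>)
      moreover have "integrable M (\<lambda>\<omega>. indicat_real A (X \<omega>))"
        by (rule integrable_const_bound[where B = 1]) auto
      ultimately show ?thesis
        using intf by (simp add: distrib_left prob_space)
    qed
    have c: "expectation (\<lambda>\<omega>. indicat_real A (X \<omega>) * cos (t * Y \<omega>)) =
        expectation (\<lambda>\<omega>. indicat_real A (X \<omega>)) * expectation (\<lambda>\<omega>. cos (t * Y \<omega>))"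
      by (rule trig[of cos "1/2" "1/2"]) (use cos_eq in \<open>auto simp: field_simps\<close>)
    have s: "expectation (\<lambda>\<omega>. indicat_real A (X \<omega>) * sin (t * Y \<omega>)) =
        expectation (\<lambda>\<omega>. indicat_real A (X \<omega>)) * expectation (\<lambda>\<omega>. sin (t * Y \<omega>))"
      by (rule trig[of sin "1/(2*\<i>)" "-1/(2*\<i>)"]) (use sin_eq in \<open>auto simp: field_simps\<close>)
    have "integrable M (\<lambda>\<omega>. indicat_real A (X \<omega>) *\<^sub>R iexp (t * Y \<omega>))"
      by (rule integrable_const_bound[where B = 1]) (auto simp: indicator_def)
    thus ?thesis
      \<comment> \<open>The identities for cosine and sine are the real and imaginary parts of the
        claim.\<close>
      using int[of "\<lambda>\<omega>. t * Y \<omega>"] c s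
      by (simp add: complex_eq_iff integral_Re[symmetric] integral_Im[symmetric] Re_exp Im_exp)
  qed
  have prod: "expectation (\<lambda>\<omega>. indicat_real B (Y \<omega>) * indicat_real A (X \<omega>)) =
      expectation (\<lambda>\<omega>. indicat_real B (Y \<omega>)) * expectation (\<lambda>\<omega>. indicat_real A (X \<omega>))"
    if [measurable]: "A \<in> sets borel" "B \<in> sets borel" for A B
  proof -
    have intA: "integrable M (\<lambda>\<omega>. indicat_real A (X \<omega>))"
      by (rule integrable_const_bound[where B = 1]) auto
    have intB: "integrable M (\<lambda>\<omega>. indicat_real B (Y \<omega>))"
      by (rule integrable_const_bound[where B = 1]) auto
    have "integrable M (\<lambda>\<omega>. indicat_real B (Y \<omega>) * indicat_real A (X \<omega>))"
      by (rule int') (auto simp: indicator_def)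
    \<comment> \<open>The roles are now exchanged: the law of \<open>Y\<close> is compared under the
      weight built from \<open>A\<close> and \<open>X\<close>, with values in {1, 2}, and
      \<open>half\<close> supplies the equality of characteristic functions.\<close>
    moreover have "expectation (\<lambda>\<omega>. indicat_real B (Y \<omega>) * (1 + indicat_real A (X \<omega>))) =
      expectation (\<lambda>\<omega>. indicat_real B (Y \<omega>)) * expectation (\<lambda>\<omega>. 1 + indicat_real A (X \<omega>))"
    proof (rule weight_independent_of_char[where c = 2])
      fix t
      have "integrable M (\<lambda>\<omega>. indicat_real A (X \<omega>) *\<^sub>R iexp (t * Y \<omega>))"
        by (rule integrable_const_bound[where B = 1]) (auto simp: indicator_def)
      thus "expectation (\<lambda>\<omega>. (1 + indicat_real A (X \<omega>)) *\<^sub>R iexp (t * Y \<omega>)) =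
          expectation (\<lambda>\<omega>. 1 + indicat_real A (X \<omega>)) *\<^sub>R expectation (\<lambda>\<omega>. iexp (t * Y \<omega>))"
        using half[of A t] int[of "\<lambda>\<omega>. t * Y \<omega>"] intA
        by (simp add: scaleR_add_left prob_space)
    qed (auto simp: indicator_def)
    ultimately show ?thesis
      using intA intB by (simp add: distrib_left prob_space)
  qed
  have "distr M borel X \<Otimes>\<^sub>M distr M borel Y = distr M (borel \<Otimes>\<^sub>M borel) (\<lambda>\<omega>. (X \<omega>, Y \<omega>))"
  proof (rule pair_measure_eqI)
    show "sigma_finite_measure (distr M borel X)" "sigma_finite_measure (distr M borel Y)"
      by (auto intro!: prob_space_imp_sigma_finite prob_space_distr)
    fix A B assume "A \<in> sets (distr M borel X)" "B \<in> sets (distr M borel Y)"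
    hence [measurable]: "A \<in> sets borel" "B \<in> sets borel" by auto
    have ind: "expectation (\<lambda>\<omega>. indicat_real S (f \<omega>)) = prob (f -` S \<inter> space M)"
      for S :: "'c set" and f
      by (simp add: indicator_vimage[symmetric] Int_commute)
    have "prob ((\<lambda>\<omega>. (X \<omega>, Y \<omega>)) -` (A \<times> B) \<inter> space M) =
        prob (X -` A \<inter> space M) * prob (Y -` B \<inter> space M)"
      unfolding ind[symmetric] using prod[of A B] by (simp add: indicator_times mult.commute)
    thus "emeasure (distr M borel X) A * emeasure (distr M borel Y) B =
        emeasure (distr M (borel \<Otimes>\<^sub>M borel) (\<lambda>\<omega>. (X \<omega>, Y \<omega>))) (A \<times> B)"
      by (simp add: emeasure_distr emeasure_eq_measure ennreal_mult[symmetric])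
  qed simp
  thus ?thesis by (simp add: indep_var_distribution_eq)
qed

section \<open>Entire exponential transforms of bounded variables\<close>

lemma exp_mult_bounded_integrable:
  fixes W :: "'a \<Rightarrow> real"
  assumes [measurable]: "random_variable borel W" and "AE \<omega> in M. \<bar>W \<omega>\<bar> \<le> B"
  shows "integrable M (\<lambda>\<omega>. exp (z * complex_of_real (W \<omega>)))"
proof (rule integrable_const_bound[where B = "exp (norm z * B)"])
  show "AE \<omega> in M. norm (exp (z * complex_of_real (W \<omega>))) \<le> exp (norm z * B)"
    using assms(2)
  proof eventually_elim
    case (elim \<omega>)
    have "norm (exp (z * complex_of_real (W \<omega>))) \<le> exp (norm (z * complex_of_real (W \<omega>)))"
      by (rule norm_exp)
    also have "\<dots> \<le> exp (norm z * B)"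
      using elim by (simp add: norm_mult mult_left_mono)
    finally show ?case .
  qed
qed auto

text \<open>Expanding the exponential and exchanging sum and expectation yields a power series whose
  coefficients are the moments of \<open>W\<close> over factorials. Boundedness of \<open>W\<close>
  makes it converge for every \<open>z\<close>.\<close>

lemma holomorphic_mgf_bounded:
  fixes W :: "'a \<Rightarrow> real"
  assumes [measurable]: "random_variable borel W" and bd: "AE \<omega> in M. \<bar>W \<omega>\<bar> \<le> B"
  shows "(\<lambda>z. expectation (\<lambda>\<omega>. exp (z * complex_of_real (W \<omega>)))) holomorphic_on UNIV"
proof -
  define c where "c n = expectation (\<lambda>\<omega>. complex_of_real (W \<omega> ^ n)) / fact n" for n
  have B: "0 \<le> \<bar>B\<bar>" "AE \<omega> in M. \<bar>W \<omega>\<bar> \<le> \<bar>B\<bar>"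
    using bd by auto
  have sums: "(\<lambda>n. c n * z ^ n) sums expectation (\<lambda>\<omega>. exp (z * complex_of_real (W \<omega>)))" for z
  proof -
    let ?f = "\<lambda>n \<omega>. (z * complex_of_real (W \<omega>)) ^ n /\<^sub>R fact n"
    \<comment> \<open>These constants are the terms of an exponential series, so one bound gives
      both the integrability of each term and the summability of the expected norms.\<close>
    have bound: "AE \<omega> in M. norm (?f n \<omega>) \<le> (norm z * \<bar>B\<bar>) ^ n /\<^sub>R fact n" for n
      using B(2) by eventually_elim
        (auto simp: norm_mult norm_power intro!: mult_left_mono power_mono)
    have int: "integrable M (?f n)" for n
      by (rule integrable_const_bound[OF bound]) auto
    have "(\<lambda>n. expectation (?f n)) sums expectation (\<lambda>\<omega>. \<Sum>n. ?f n \<omega>)"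
    proof (rule sums_integral[OF int])
      show "AE \<omega> in M. summable (\<lambda>n. norm (?f n \<omega>))"
        by (intro AE_I2 summable_norm_exp)
      show "summable (\<lambda>n. expectation (\<lambda>\<omega>. norm (?f n \<omega>)))"
      proof (rule summable_comparison_test')
        show "summable (\<lambda>n. (norm z * \<bar>B\<bar>) ^ n /\<^sub>R fact n)"
          by (rule summable_exp_generic)
        fix n :: nat assume "0 \<le> n"
        have "expectation (\<lambda>\<omega>. norm (?f n \<omega>)) \<le> expectation (\<lambda>\<omega>. (norm z * \<bar>B\<bar>) ^ n /\<^sub>R fact n)"
          by (rule integral_mono_AE[OF integrable_norm[OF int] _ bound]) simp
        thus "norm (expectation (\<lambda>\<omega>. norm (?f n \<omega>))) \<le> (norm z * \<bar>B\<bar>) ^ n /\<^sub>R fact n"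
          by (simp add: prob_space)
      qed
    qed
    moreover have "expectation (?f n) = c n * z ^ n" for n
    proof -
      have "?f n = (\<lambda>\<omega>. (z ^ n / fact n) * complex_of_real (W \<omega> ^ n))"
        by (auto simp: fun_eq_iff scaleR_conv_of_real power_mult_distrib field_simps)
      thus ?thesis by (simp only: integral_mult_right_zero) (simp add: c_def)
    qed
    ultimately show ?thesis by (simp add: exp_def)
  qed
  show ?thesis unfolding holomorphic_on_def
  proof
    fix z :: complex
    \<comment> \<open>Holomorphy of a power series is obtained on a disc; this radius makes the disc
      contain the given \<open>z\<close>.\<close>
    have "(\<lambda>z. expectation (\<lambda>\<omega>. exp (z * complex_of_real (W \<omega>)))) holomorphic_on ball 0 (norm z + 1)"
      by (rule power_series_holomorphic[where a = c]) (use sums in simp)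
    hence "(\<lambda>z. expectation (\<lambda>\<omega>. exp (z * complex_of_real (W \<omega>)))) field_differentiable at z"
      by (rule holomorphic_on_imp_differentiable_at) auto
    thus "(\<lambda>z. expectation (\<lambda>\<omega>. exp (z * complex_of_real (W \<omega>)))) field_differentiable at z within UNIV"
      by simp
  qed
qed

end

section \<open>Transfer along equal laws, and square roots of entire functions\<close>

lemma identically_distributed_comp:
  fixes h :: "'b::topological_space \<Rightarrow> 'c::{banach, second_countable_topology}"
  assumes "identically_distributed M Z W" and "h \<in> borel_measurable borel"
  shows "integral\<^sup>L M (\<lambda>\<omega>. h (Z \<omega>)) = integral\<^sup>L M (\<lambda>\<omega>. h (W \<omega>))"
    and "integrable M (\<lambda>\<omega>. h (Z \<omega>)) \<longleftrightarrow> integrable M (\<lambda>\<omega>. h (W \<omega>))"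
  using assms integral_distr[of Z M borel h] integral_distr[of W M borel h]
    integrable_distr_eq[of Z M borel h] integrable_distr_eq[of W M borel h]
  by (auto simp: identically_distributed_def)

text \<open>The product of \<open>f - g\<close> and \<open>f + g\<close> vanishes identically. The
  common nonzero value at \<open>a\<close> keeps \<open>f + g\<close> away from 0 near
  \<open>a\<close>, which rules out the sign -1 there, and analytic continuation spreads the local
  equality to the whole plane.\<close>

lemma holomorphic_square_eq_imp_eq:
  fixes f g :: "complex \<Rightarrow> complex"
  assumes f: "f holomorphic_on UNIV" and g: "g holomorphic_on UNIV"
    and sq: "\<And>z. (f z)\<^sup>2 = (g z)\<^sup>2" and eq: "f a = g a" and nz: "f a \<noteq> 0"
  shows "f z = g z"
proof -
  have "continuous (at a) (\<lambda>z. f z + g z)"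
    using holomorphic_on_imp_continuous_on[OF f] holomorphic_on_imp_continuous_on[OF g]
    by (simp add: continuous_on_eq_continuous_at continuous_add)
  moreover have "f a + g a \<noteq> 0" using eq nz by simp
  ultimately have "\<forall>\<^sub>F z in nhds a. f z + g z \<noteq> 0"
    by (simp add: continuous_at eventually_nhds_conv_at tendsto_imp_eventually_ne)
  then obtain S where S: "open S" "a \<in> S" "\<And>z. z \<in> S \<Longrightarrow> f z + g z \<noteq> 0"
    by (auto simp: eventually_nhds)
  show ?thesis
  proof (rule analytic_continuation_open[of S UNIV f g])
    fix z assume "z \<in> S"
    with S(3) have "f z \<noteq> - g z" by (metis add.left_inverse)
    with sq[of z] show "f z = g z" by (auto simp: power2_eq_iff)
  qed (use S f g in auto)
qed

section \<open>Factorization of the transform of a symmetric vector\<close>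

theorem theorem2:
  fixes M :: "'a measure" and X Y X' Y' :: "'a \<Rightarrow> real"
  assumes "prob_space M"
    and "X \<in> borel_measurable M" and "Y \<in> borel_measurable M"
    and "X' \<in> borel_measurable M" and "Y' \<in> borel_measurable M"
    and "prob_space.indep_var M borel (\<lambda>\<omega>. (X \<omega>, Y \<omega>)) borel (\<lambda>\<omega>. (X' \<omega>, Y' \<omega>))"
    and "identically_distributed M (\<lambda>\<omega>. (X \<omega>, Y \<omega>)) (\<lambda>\<omega>. (X' \<omega>, Y' \<omega>))"
    and "bounded_joint M X Y"
    and "symmetric_joint M X Y"
    and "prob_space.indep_var M borel (\<lambda>\<omega>. X \<omega> - X' \<omega>) borel (\<lambda>\<omega>. Y \<omega> - Y' \<omega>)"
  shows "prob_space.indep_var M borel X borel Y"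
proof -
  interpret prob_space M by fact
  note [measurable] = assms(2-5)
  note id = assms(7)
  have sym: "identically_distributed M (\<lambda>\<omega>. (X \<omega>, Y \<omega>)) (\<lambda>\<omega>. (- X \<omega>, - Y \<omega>))"
    using assms(9) by (simp add: symmetric_joint_def)
  obtain B C where BC: "AE \<omega> in M. \<bar>X \<omega>\<bar> \<le> B" "AE \<omega> in M. \<bar>Y \<omega>\<bar> \<le> C"
    using assms(8) by (auto simp: bounded_joint_def as_bounded_def)
  have bd: "AE \<omega> in M. \<bar>s * X \<omega> + t * Y \<omega>\<bar> \<le> \<bar>s\<bar> * B + \<bar>t\<bar> * C" for s t
    using BC
  proof eventually_elim
    case (elim \<omega>)
    have "\<bar>s * X \<omega> + t * Y \<omega>\<bar> \<le> \<bar>s\<bar> * \<bar>X \<omega>\<bar> + \<bar>t\<bar> * \<bar>Y \<omega>\<bar>"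
      using abs_triangle_ineq[of "s * X \<omega>" "t * Y \<omega>"] by (simp add: abs_mult)
    also have "\<dots> \<le> \<bar>s\<bar> * B + \<bar>t\<bar> * C"
      using elim by (intro add_mono mult_left_mono) auto
    finally show ?case .
  qed
  \<comment> \<open>Taking the pair as a single argument gives one Borel function that can be
    composed with the vector, its copy, its negative and the difference.\<close>
  define e where "e s t z p = exp (z * complex_of_real (s * fst p + t * snd p))" for s t z p
  have e_meas [measurable]: "e s t z \<in> borel_measurable borel" for s t z
    unfolding e_def by (intro borel_measurable_continuous_onI continuous_intros)
  define F where "F s t z = expectation (\<lambda>\<omega>. e s t z (X \<omega>, Y \<omega>))" for s t z
  have int: "integrable M (\<lambda>\<omega>. e s t z (X \<omega>, Y \<omega>))" for s t z
    unfolding e_def using exp_mult_bounded_integrable[OF _ bd[of s t], of z] by simp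
  \<comment> \<open>Boundedness is assumed for \<open>(X, Y)\<close> only; the copy gets
    integrability from the equality of laws.\<close>
  have int': "integrable M (\<lambda>\<omega>. e s t z (X' \<omega>, Y' \<omega>))" for s t z
    using int identically_distributed_comp(2)[OF id e_meas] by blast
  have F_neg: "F s t (- z) = F s t z" for s t z
  proof -
    have "F s t (- z) = expectation (\<lambda>\<omega>. e s t (- z) (- X \<omega>, - Y \<omega>))"
      unfolding F_def by (rule identically_distributed_comp(1)[OF sym e_meas])
    also have "(\<lambda>\<omega>. e s t (- z) (- X \<omega>, - Y \<omega>)) = (\<lambda>\<omega>. e s t z (X \<omega>, Y \<omega>))"
      by (simp add: e_def fun_eq_iff algebra_simps)
    finally show ?thesis by (simp add: F_def)
  qed
  \<comment> \<open>The minus sign is moved from the copy to the parameter, so that the second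
    factor has expectation \<open>F s t (- z)\<close>.\<close>
  have e_diff: "e s t z (X \<omega> - X' \<omega>, Y \<omega> - Y' \<omega>) = e s t z (X \<omega>, Y \<omega>) * e s t (- z) (X' \<omega>, Y' \<omega>)"
    for s t z \<omega>
    by (simp add: e_def exp_add[symmetric] algebra_simps)
  have ind: "indep_var borel (\<lambda>\<omega>. e s t z (X \<omega>, Y \<omega>)) borel (\<lambda>\<omega>. e s t (- z) (X' \<omega>, Y' \<omega>))" for s t z
    using indep_var_compose[OF assms(6) e_meas e_meas] by (simp add: comp_def)
  have F_sq: "expectation (\<lambda>\<omega>. e s t z (X \<omega> - X' \<omega>, Y \<omega> - Y' \<omega>)) = (F s t z)\<^sup>2" for s t z
  proof -
    have "expectation (\<lambda>\<omega>. e s t z (X \<omega> - X' \<omega>, Y \<omega> - Y' \<omega>)) =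
        F s t z * expectation (\<lambda>\<omega>. e s t (- z) (X' \<omega>, Y' \<omega>))"
      unfolding e_diff F_def by (rule indep_var_lebesgue_integral[OF ind int int'])
    also have "expectation (\<lambda>\<omega>. e s t (- z) (X' \<omega>, Y' \<omega>)) = F s t (- z)"
      unfolding F_def by (rule identically_distributed_comp(1)[OF id e_meas, symmetric])
    finally show ?thesis by (simp add: F_neg power2_eq_square)
  qed
  have int_diff: "integrable M (\<lambda>\<omega>. e s t z (X \<omega> - X' \<omega>, Y \<omega> - Y' \<omega>))" for s t z
    unfolding e_diff by (rule indep_var_integrable[OF ind int int'])
  \<comment> \<open>The exponential of the differences splits into a function of
    \<open>X - X'\<close> and a function of \<open>Y - Y'\<close>, whose independence factors the
    expectation. \<open>F_sq\<close> then turns all three expectations into squares.\<close>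
  have sq: "(F s t z)\<^sup>2 = (F s 0 z * F 0 t z)\<^sup>2" for s t z
  proof -
    have "e s t z (X \<omega> - X' \<omega>, Y \<omega> - Y' \<omega>) =
        e s 0 z (X \<omega> - X' \<omega>, Y \<omega> - Y' \<omega>) * e 0 t z (X \<omega> - X' \<omega>, Y \<omega> - Y' \<omega>)" for \<omega>
      by (simp add: e_def exp_add[symmetric] algebra_simps)
    moreover have "indep_var borel (\<lambda>\<omega>. e s 0 z (X \<omega> - X' \<omega>, Y \<omega> - Y' \<omega>))
        borel (\<lambda>\<omega>. e 0 t z (X \<omega> - X' \<omega>, Y \<omega> - Y' \<omega>))"
      using indep_var_compose[OF assms(10), of "\<lambda>x. exp (z * complex_of_real (s * x))" borel
          "\<lambda>y. exp (z * complex_of_real (t * y))" borel]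
      by (simp add: comp_def e_def)
    ultimately have "expectation (\<lambda>\<omega>. e s t z (X \<omega> - X' \<omega>, Y \<omega> - Y' \<omega>)) =
        expectation (\<lambda>\<omega>. e s 0 z (X \<omega> - X' \<omega>, Y \<omega> - Y' \<omega>)) *
        expectation (\<lambda>\<omega>. e 0 t z (X \<omega> - X' \<omega>, Y \<omega> - Y' \<omega>))"
      by (simp add: indep_var_lebesgue_integral int_diff)
    thus ?thesis by (simp add: F_sq power_mult_distrib)
  qed
  have holo: "F s t holomorphic_on UNIV" for s t
    unfolding F_def e_def using holomorphic_mgf_bounded[OF _ bd[of s t]] by simp
  \<comment> \<open>At 0 both sides equal 1, which fixes the sign of the square root.\<close>
  have F_eq: "F s t z = F s 0 z * F 0 t z" for s t z
    by (rule holomorphic_square_eq_imp_eq[of "F s t" "\<lambda>z. F s 0 z * F 0 t z" 0])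
       (intro holo sq holomorphic_on_mult | simp add: F_def e_def prob_space)+
  show ?thesis
  proof (rule indep_varI_char)
    show "expectation (\<lambda>\<omega>. iexp (s * X \<omega> + t * Y \<omega>)) =
      expectation (\<lambda>\<omega>. iexp (s * X \<omega>)) * expectation (\<lambda>\<omega>. iexp (t * Y \<omega>))" for s t
      using F_eq[of s t \<i>] by (simp add: F_def e_def)
  qed simp_all
qed

end
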